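(* Let $\gamma>1$ and $\phi=\frac{2}{1+\gamma}$. For $\lambda>0$ let $V_\lambda:\mathbb{R}_+\to\mathbb{R}_+$ be a solution of the ODE problem $$-V_\lambda''(t)=\left(V_\lambda(t)\right)^{-\gamma}\ \text{ for }t>0,\qquad V_\lambda'(t)\to\lambda\ \text{ as }t\to\infty,\qquad V_\lambda(0)=0.$$ Then for all $\lambda>0$ and $t>0$, $$V_\lambda(t)\sim\begin{cases}t^{\phi},&\text{if }t\le\lambda^{\frac{1+\gamma}{1-\gamma}},\\ \lambda t,&\text{if }t\ge\lambda^{\frac{1+\gamma}{1-\gamma}}.\end{cases}$$ In particular, for $\lambda\gtrsim1$ we have $V_\lambda(1)\sim\lambda$. Moreover, for all $\lambda>0$ and $t>0$, $$V_\lambda'(t)\sim\begin{cases}t^{\phi-1},&\text{if }t\le\lambda^{\frac{1+\gamma}{1-\gamma}},\\ \lambda,&\text{if }t\ge\lambda^{\frac{1+\gamma}{1-\gamma}}.\end{cases}$$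
   Context: $q_1\sim q_2$ means $C^{-1}q_2\le q_1\le Cq_2$ with a constant $C>0$ depending only on $\gamma$, not on $\lambda$ or $t$. "For $\lambda\gtrsim1$ we have $V_\lambda(1)\sim\lambda$" means: for every $c_0>0$, whenever $\lambda\ge c_0$, $V_\lambda(1)$ and $\lambda$ are comparable with a constant depending only on $\gamma$ and $c_0$. $V_\lambda$ is positive and $C^2$ on $(0,\infty)$ and continuous at $0$. *)

theory Defs
  imports "HOL-Analysis.Analysis"
begin

definition comparable_with :: "real \<Rightarrow> real \<Rightarrow> real \<Rightarrow> bool" where
  "comparable_with C q1 q2 \<longleftrightarrow> inverse C * q2 \<le> q1 \<and> q1 \<le> C * q2"

definition C2_on_pos :: "(real \<Rightarrow> real) \<Rightarrow> bool" where
  "C2_on_pos V \<longleftrightarrow>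
     (\<forall>t>0. V field_differentiable at t) \<and>
     (\<forall>t>0. deriv V field_differentiable at t) \<and>
     continuous_on {0<..} (deriv (deriv V))"

text \<open>
  The function is defined on the closed half-line and its values at negative arguments
  are never referred to; continuity at 0 is one-sided.
\<close>

definition ode_solution :: "real \<Rightarrow> real \<Rightarrow> (real \<Rightarrow> real) \<Rightarrow> bool" where
  "ode_solution \<gamma> lam V \<longleftrightarrow>
     continuous_on {0..} V \<and>
     (\<forall>t>0. V t > 0) \<and>
     C2_on_pos V \<and>
     (\<forall>t>0. - deriv (deriv V) t = V t powr (- \<gamma>)) \<and>
     (deriv V \<longlongrightarrow> lam) at_top \<and>
     V 0 = 0"

end

theory Submission
  imports Defs
begin

text \<open>
  The energy \<open>V'\<^sup>2 - 2/(\<gamma>-1) V\<^bsup>1-\<gamma>\<^esup>\<close> is conserved, and its value is \<open>\<lambda>\<^sup>2\<close> by letting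
  \<open>t \<rightarrow> \<infinity>\<close>. Hence \<open>V' \<ge> s V\<^bsup>(1-\<gamma>)/2\<^esup>\<close> with \<open>s = (2/(\<gamma>-1))\<^bsup>1/2\<^esup>\<close>, which integrates to
  \<open>V\<^bsup>(1+\<gamma>)/2\<^esup> \<ge> k t\<close> with \<open>k = s (1+\<gamma>)/2\<close>. Inserting this lower bound into
  \<open>V' \<le> \<lambda> + s V\<^bsup>(1-\<gamma>)/2\<^esup>\<close> gives \<open>V' \<le> \<lambda> + B t\<^bsup>\<phi>-1\<^esup>\<close>, and by integration
  \<open>V \<le> \<lambda> t + (B/\<phi>) t\<^bsup>\<phi>\<^esup>\<close>. The two terms balance exactly at \<open>t = \<lambda>\<^bsup>(1+\<gamma>)/(1-\<gamma>)\<^esup>\<close>.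
\<close>

section \<open>Setting, exponents and regularity of a solution\<close>

locale ode_problem =
  fixes \<gamma> \<phi> lam :: real and V :: "real \<Rightarrow> real"
  assumes gamma: "\<gamma> > 1" and phi: "\<phi> = 2 / (1 + \<gamma>)" and lam: "lam > 0"
    and sol: "ode_solution \<gamma> lam V"
begin

lemma phi_bounds: "0 < \<phi>" "\<phi> < 1"
  using gamma by (auto simp: phi field_simps)

text \<open>The first identity inverts the power \<open>(1 + \<gamma>) / 2\<close>, in which the
  lower bound for V integrates; the second turns growth \<open>t powr \<phi>\<close> of V into the
  rate \<open>t powr (\<phi> - 1)\<close> of its derivative.\<close>

lemma phi_half: "\<phi> * ((1 + \<gamma>) / 2) = 1" "\<phi> * ((1 - \<gamma>) / 2) = \<phi> - 1"
  using gamma by (auto simp: phi field_simps)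

lemma V_pos: "t > 0 \<Longrightarrow> V t > 0"
  and V_zero: "V 0 = 0"
  and V_deriv_lim: "(deriv V \<longlongrightarrow> lam) at_top"
  using sol by (auto simp: ode_solution_def)

lemma V_nonneg: "t \<ge> 0 \<Longrightarrow> V t \<ge> 0"
  using V_pos[of t] V_zero by (cases "t = 0") auto

lemma V_cont: "continuous_on {0..t} V"
  using sol by (auto simp: ode_solution_def intro: continuous_on_subset)

lemma V_deriv: "t > 0 \<Longrightarrow> (V has_real_derivative deriv V t) (at t)"
  using sol by (simp add: ode_solution_def C2_on_pos_def DERIV_deriv_iff_field_differentiable)

lemma V_deriv2: "t > 0 \<Longrightarrow> (deriv V has_real_derivative - (V t powr (- \<gamma>))) (at t)"
proof -
  assume t: "t > 0"
  then have "- deriv (deriv V) t = V t powr (- \<gamma>)"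
    using sol by (simp add: ode_solution_def)
  then have "deriv (deriv V) t = - (V t powr (- \<gamma>))" by simp
  with t show ?thesis
    using sol by (metis ode_solution_def C2_on_pos_def DERIV_deriv_iff_field_differentiable)
qed

section \<open>Linear lower bounds from concavity\<close>

text \<open>The equation makes V concave, so its derivative decreases towards its limit and stays
  above it.\<close>

lemma deriv_ge_lam: "t > 0 \<Longrightarrow> deriv V t \<ge> lam"
proof -
  assume t: "t > 0"
  have "deriv V u \<le> deriv V t" if "u \<ge> t" for u
  proof (rule DERIV_nonpos_imp_nonincreasing[OF that])
    fix x assume "t \<le> x" "x \<le> u"
    with t show "\<exists>y. DERIV (deriv V) x :> y \<and> y \<le> 0"
      by (intro exI[of _ "- (V x powr (- \<gamma>))"] conjI V_deriv2) auto
  qed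
  then have "\<forall>\<^sub>F u in at_top. deriv V u \<le> deriv V t"
    by (rule eventually_mono[OF eventually_ge_at_top])
  with V_deriv_lim show ?thesis
    by (intro tendsto_upperbound[of "deriv V" lam at_top]) auto
qed

lemma V_ge_linear: "t \<ge> 0 \<Longrightarrow> V t \<ge> lam * t"
proof -
  assume t: "t \<ge> 0"
  have "V 0 - lam * 0 \<le> V t - lam * t"
  \<comment> \<open>Derivatives are available only for positive arguments; at the endpoint 0
    continuity suffices.\<close>
  proof (rule DERIV_nonneg_imp_increasing_open[OF t])
    show "continuous_on {0..t} (\<lambda>x. V x - lam * x)"
      by (intro continuous_intros V_cont)
    fix x assume "0 < x" "x < t"
    then show "\<exists>y. DERIV (\<lambda>x. V x - lam * x) x :> y \<and> 0 \<le> y"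
      using deriv_ge_lam[of x]
      by (intro exI[of _ "deriv V x - lam"]) (auto intro!: derivative_eq_intros V_deriv)
  qed
  then show ?thesis by (simp add: V_zero)
qed

section \<open>The energy identity and its consequences for the derivative\<close>

text \<open>Multiplying the equation by \<open>-2 * deriv V t\<close> turns both sides into exact
  derivatives, so their primitives differ by a constant.\<close>

lemma energy:
  assumes t: "t > 0"
  shows "(deriv V t)\<^sup>2 = lam\<^sup>2 + 2 / (\<gamma> - 1) * V t powr (1 - \<gamma>)"
proof -
  define E where "E = (\<lambda>t. (deriv V t)\<^sup>2 - 2 / (\<gamma> - 1) * V t powr (1 - \<gamma>))"
  have "(E has_real_derivative 0) (at x)" if x: "x > 0" for x
  proof -
    have "(E has_real_derivative
        2 * deriv V x * (- (V x powr (- \<gamma>))) -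
        2 / (\<gamma> - 1) * ((1 - \<gamma>) * V x powr (1 - \<gamma> - 1) * deriv V x)) (at x)"
      unfolding E_def using x V_pos[OF x] gamma
      by (auto intro!: derivative_eq_intros V_deriv V_deriv2)
    moreover have "2 / (\<gamma> - 1) * ((1 - \<gamma>) * V x powr (1 - \<gamma> - 1) * deriv V x)
        = - 2 * V x powr (- \<gamma>) * deriv V x"
      using gamma by (simp add: field_simps)
    ultimately show ?thesis by simp
  qed
  then have "\<exists>c. \<forall>x\<in>{0<..}. E x = c"
    by (intro has_field_derivative_zero_constant)
      (auto intro: has_field_derivative_at_within)
  then obtain c where c: "\<And>x. x > 0 \<Longrightarrow> E x = c" by auto
  \<comment> \<open>Since \<open>1 - \<gamma> < 0\<close>, growth of V to infinity kills the
    potential term in the limit, leaving \<open>lam\<^sup>2\<close> as the constant.\<close>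
  have "filterlim V at_top at_top"
  proof (rule filterlim_at_top_mono)
    show "filterlim (\<lambda>t. lam * t) at_top at_top"
      using lam by (intro filterlim_tendsto_pos_mult_at_top[OF tendsto_const] filterlim_ident)
    show "\<forall>\<^sub>F x in at_top. lam * x \<le> V x"
      using eventually_ge_at_top[of 0] by eventually_elim (rule V_ge_linear)
  qed
  then have "((\<lambda>t. V t powr (1 - \<gamma>)) \<longlongrightarrow> 0) at_top"
    using gamma by (intro tendsto_neg_powr) auto
  then have "(E \<longlongrightarrow> lam\<^sup>2 - 2 / (\<gamma> - 1) * 0) at_top"
    unfolding E_def by (intro tendsto_intros V_deriv_lim)
  moreover have "(E \<longlongrightarrow> c) at_top"
    by (intro tendsto_eventually eventually_mono[OF eventually_gt_at_top[of 0]] c)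
  ultimately have "c = lam\<^sup>2"
    using tendsto_unique[OF trivial_limit_at_top_linorder] by fastforce
  with c[OF t] show ?thesis by (simp add: E_def)
qed

text \<open>As a sum of two squares of nonnegative numbers, the energy bounds the derivative below
  by either root and above by the sum of the roots.\<close>

lemma energy_sqrt:
  assumes "t > 0"
  shows "(deriv V t)\<^sup>2 = lam\<^sup>2 + (sqrt (2 / (\<gamma> - 1)) * V t powr ((1 - \<gamma>) / 2))\<^sup>2"
proof -
  have "(V t powr ((1 - \<gamma>) / 2))\<^sup>2 = V t powr (1 - \<gamma>)"
    by (simp add: power2_eq_square flip: powr_add)
  then show ?thesis
    using energy[OF assms] gamma by (simp add: power_mult_distrib)
qed

lemma deriv_ge_power:
  assumes "t > 0"
  shows "deriv V t \<ge> sqrt (2 / (\<gamma> - 1)) * V t powr ((1 - \<gamma>) / 2)"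
proof (rule power2_le_imp_le)
  show "(sqrt (2 / (\<gamma> - 1)) * V t powr ((1 - \<gamma>) / 2))\<^sup>2 \<le> (deriv V t)\<^sup>2"
    by (simp add: energy_sqrt[OF assms])
  show "0 \<le> deriv V t"
    using deriv_ge_lam[OF assms] lam by linarith
qed

lemma deriv_le:
  assumes "t > 0"
  shows "deriv V t \<le> lam + sqrt (2 / (\<gamma> - 1)) * V t powr ((1 - \<gamma>) / 2)"
proof (rule power2_le_imp_le)
  have "0 \<le> sqrt (2 / (\<gamma> - 1)) * V t powr ((1 - \<gamma>) / 2)"
    using gamma by simp
  then show "0 \<le> lam + sqrt (2 / (\<gamma> - 1)) * V t powr ((1 - \<gamma>) / 2)"
    and "(deriv V t)\<^sup>2 \<le> (lam + sqrt (2 / (\<gamma> - 1)) * V t powr ((1 - \<gamma>) / 2))\<^sup>2"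
    using lam by (simp_all add: energy_sqrt[OF assms] power2_sum)
qed

section \<open>Power bounds with explicit constants\<close>

lemma V_ge_power:
  assumes t: "t > 0"
  shows "V t \<ge> ((1 + \<gamma>) / 2 * sqrt (2 / (\<gamma> - 1)) * t) powr \<phi>"
proof -
  define p k where "p = (1 + \<gamma>) / 2" and "k = (1 + \<gamma>) / 2 * sqrt (2 / (\<gamma> - 1))"
  have p: "p > 0" using gamma by (simp add: p_def)
  have k: "k > 0" using gamma by (simp add: k_def)
  \<comment> \<open>The left side is 0, because \<open>0 powr p = 0\<close>; continuity at 0 uses
    \<open>p > 0\<close>.\<close>
  have "V 0 powr p - k * 0 \<le> V t powr p - k * t"
  proof (rule DERIV_nonneg_imp_increasing_open[where f = "\<lambda>x. V x powr p - k * x"])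
    show "continuous_on {0..t} (\<lambda>x. V x powr p - k * x)"
    proof (rule continuous_on_diff)
      show "continuous_on {0..t} (\<lambda>x. V x powr p)"
        by (rule continuous_on_powr'[OF V_cont continuous_on_const]) (use V_nonneg p in auto)
    qed (intro continuous_intros)
    fix x assume "0 < x" "x < t"
    then have x: "x > 0" by simp
    \<comment> \<open>The exponent p is chosen for this cancellation: the derivative of
      \<open>V x powr p\<close> is then bounded below by a constant, namely k.\<close>
    have "V x powr (p - 1) * V x powr ((1 - \<gamma>) / 2) = 1"
    proof -
      have "p - 1 + (1 - \<gamma>) / 2 = 0" by (simp add: p_def field_simps)
      then show ?thesis using V_pos[OF x] by (metis powr_add powr_zero_eq_one less_irrefl)
    qed
    then have "k = p * V x powr (p - 1) * (sqrt (2 / (\<gamma> - 1)) * V x powr ((1 - \<gamma>) / 2))"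
      by (simp add: k_def p_def)
    also have "\<dots> \<le> p * V x powr (p - 1) * deriv V x"
      using p by (intro mult_left_mono deriv_ge_power x) auto
    finally show "\<exists>y. DERIV (\<lambda>x. V x powr p - k * x) x :> y \<and> 0 \<le> y"
      using V_pos[OF x] x
      by (intro exI[of _ "p * V x powr (p - 1) * deriv V x - k"])
        (auto intro!: derivative_eq_intros V_deriv)
  qed (use t in simp)
  then have "k * t \<le> V t powr p" using p by (simp add: V_zero)
  then have "(k * t) powr \<phi> \<le> (V t powr p) powr \<phi>"
    using k t phi_bounds by (intro powr_mono2) auto
  also have "\<dots> = V t"
    using V_pos[OF t] phi_half(1) by (simp add: powr_powr p_def mult.commute)
  finally show ?thesis by (simp add: k_def)
qed

text \<open>The exponent \<open>(1 - \<gamma>) / 2\<close> is negative, so the lower bound for V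
  becomes an upper bound here.\<close>

lemma deriv_le_power:
  assumes t: "t > 0"
  shows "deriv V t \<le> lam + sqrt (2 / (\<gamma> - 1)) *
    ((1 + \<gamma>) / 2 * sqrt (2 / (\<gamma> - 1))) powr (\<phi> - 1) * t powr (\<phi> - 1)"
proof -
  define k where "k = (1 + \<gamma>) / 2 * sqrt (2 / (\<gamma> - 1))"
  have k: "k > 0" using gamma by (simp add: k_def)
  have "V t powr ((1 - \<gamma>) / 2) \<le> ((k * t) powr \<phi>) powr ((1 - \<gamma>) / 2)"
    using V_ge_power[OF t] k t gamma by (intro powr_mono2') (auto simp: k_def)
  also have "\<dots> = k powr (\<phi> - 1) * t powr (\<phi> - 1)"
    unfolding powr_powr phi_half(2) using k t by (simp add: powr_mult)
  finally have "sqrt (2 / (\<gamma> - 1)) * V t powr ((1 - \<gamma>) / 2)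
      \<le> sqrt (2 / (\<gamma> - 1)) * (k powr (\<phi> - 1) * t powr (\<phi> - 1))"
    using gamma by (intro mult_left_mono) auto
  with deriv_le[OF t] show ?thesis by (simp add: k_def mult.assoc)
qed

lemma V_le_power:
  assumes t: "t > 0"
  shows "V t \<le> lam * t + sqrt (2 / (\<gamma> - 1)) *
    ((1 + \<gamma>) / 2 * sqrt (2 / (\<gamma> - 1))) powr (\<phi> - 1) / \<phi> * t powr \<phi>"
proof -
  define B where "B = sqrt (2 / (\<gamma> - 1)) * ((1 + \<gamma>) / 2 * sqrt (2 / (\<gamma> - 1))) powr (\<phi> - 1)"
  \<comment> \<open>The comparison function is the primitive of the bound for the derivative that
    vanishes at 0; \<open>\<phi> > 0\<close> makes it continuous there.\<close>
  have "lam * 0 + B / \<phi> * 0 powr \<phi> - V 0 \<le> lam * t + B / \<phi> * t powr \<phi> - V t"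
  proof (rule DERIV_nonneg_imp_increasing_open[where f = "\<lambda>x. lam * x + B / \<phi> * x powr \<phi> - V x"])
    show "continuous_on {0..t} (\<lambda>x. lam * x + B / \<phi> * x powr \<phi> - V x)"
      using phi_bounds by (intro continuous_intros continuous_on_powr' V_cont) auto
    fix x assume "0 < x" "x < t"
    then show "\<exists>y. DERIV (\<lambda>x. lam * x + B / \<phi> * x powr \<phi> - V x) x :> y \<and> 0 \<le> y"
      using deriv_le_power[of x] phi_bounds
      by (intro exI[of _ "lam + B * x powr (\<phi> - 1) - deriv V x"])
        (auto intro!: derivative_eq_intros V_deriv simp: B_def)
  qed (use t in simp)
  then show ?thesis by (simp add: V_zero B_def)
qed

text \<open>The threshold is the point where \<open>t powr (\<phi> - 1)\<close> equals lam, and this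
  power decreases in t because \<open>\<phi> < 1\<close>.\<close>

lemma threshold:
  assumes t: "t > 0"
  shows "t \<le> lam powr ((1 + \<gamma>) / (1 - \<gamma>)) \<Longrightarrow> lam \<le> t powr (\<phi> - 1)"
    and "t \<ge> lam powr ((1 + \<gamma>) / (1 - \<gamma>)) \<Longrightarrow> t powr (\<phi> - 1) \<le> lam"
proof -
  have "(1 + \<gamma>) / (1 - \<gamma>) * (\<phi> - 1) = 1"
    using gamma by (simp add: phi divide_simps)
  then have *: "(lam powr ((1 + \<gamma>) / (1 - \<gamma>))) powr (\<phi> - 1) = lam"
    using lam by (simp only: powr_powr powr_one)
  show "lam \<le> t powr (\<phi> - 1)" if "t \<le> lam powr ((1 + \<gamma>) / (1 - \<gamma>))"
    using powr_mono2'[OF _ t that, of "\<phi> - 1"] phi_bounds * by simp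
  show "t powr (\<phi> - 1) \<le> lam" if "t \<ge> lam powr ((1 + \<gamma>) / (1 - \<gamma>))"
    using powr_mono2'[OF _ _ that, of "\<phi> - 1"] phi_bounds lam * by simp
qed

end

section \<open>Uniform constants and assembly of the three claims\<close>

text \<open>Lets the lower and upper bounds carry separate constants, both absorbed into one
  C.\<close>

lemma comparable_withI:
  assumes "c > 0" "q2 \<ge> 0" "c * q2 \<le> q1" "q1 \<le> d * q2" "inverse c \<le> C" "d \<le> C"
  shows "comparable_with C q1 q2"
proof -
  have "inverse C \<le> c"
    using assms(1,5) by (metis inverse_inverse_eq inverse_positive_iff_positive le_imp_inverse_le)
  then have "inverse C * q2 \<le> c * q2" "d * q2 \<le> C * q2"
    using assms by (auto intro: mult_right_mono)
  with assms show ?thesis by (simp add: comparable_with_def)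
qed

theorem lemma3p3:
  fixes \<gamma> \<phi> :: real
  assumes "\<gamma> > 1" and "\<phi> = 2 / (1 + \<gamma>)"
  shows
    "(\<exists>C>0. \<forall>lam>0. \<forall>V. ode_solution \<gamma> lam V \<longrightarrow> (\<forall>t>0.
        (t \<le> lam powr ((1 + \<gamma>) / (1 - \<gamma>)) \<longrightarrow> comparable_with C (V t) (t powr \<phi>)) \<and>
        (t \<ge> lam powr ((1 + \<gamma>) / (1 - \<gamma>)) \<longrightarrow> comparable_with C (V t) (lam * t))))
     \<and> (\<forall>c0>0. \<exists>C>0. \<forall>lam>0. lam \<ge> c0 \<longrightarrow>
          (\<forall>V. ode_solution \<gamma> lam V \<longrightarrow> comparable_with C (V 1) lam))
     \<and> (\<exists>C>0. \<forall>lam>0. \<forall>V. ode_solution \<gamma> lam V \<longrightarrow> (\<forall>t>0.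
        (t \<le> lam powr ((1 + \<gamma>) / (1 - \<gamma>)) \<longrightarrow> comparable_with C (deriv V t) (t powr (\<phi> - 1))) \<and>
        (t \<ge> lam powr ((1 + \<gamma>) / (1 - \<gamma>)) \<longrightarrow> comparable_with C (deriv V t) lam)))"
proof -
  define s where "s = sqrt (2 / (\<gamma> - 1))"
  define k where "k = (1 + \<gamma>) / 2 * s"
  define B where "B = s * k powr (\<phi> - 1)"
  \<comment> \<open>The sum of the coefficients of \<open>lam * t\<close> and
    \<open>t powr \<phi>\<close> in the upper bound for V: on each side of the threshold one of
    these terms dominates, and V is at most D times it.\<close>
  define D where "D = 1 + B / \<phi>"
  \<comment> \<open>Arises from inserting \<open>V t \<le> D * t powr \<phi>\<close> into the lower
    bound \<open>s * V t powr ((1 - \<gamma>) / 2)\<close> for the derivative.\<close>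
  define m where "m = s * D powr ((1 - \<gamma>) / 2)"
  have pos: "s > 0" "k > 0" "B > 0" "\<phi> > 0"
    using assms by (auto simp: s_def k_def B_def)
  have D: "D > 0" using pos by (simp add: D_def add_pos_pos)
  have m: "m > 0" using pos D by (simp add: m_def)
  have V_upper: "V t \<le> lam * t + B / \<phi> * t powr \<phi>"
    and V_lower: "k powr \<phi> * t powr \<phi> \<le> V t"
    and dV_upper: "deriv V t \<le> lam + B * t powr (\<phi> - 1)"
    if "ode_problem \<gamma> \<phi> lam V" "t > 0" for lam V t
    using ode_problem.V_le_power[OF that, folded s_def, folded k_def, folded B_def]
      ode_problem.V_ge_power[OF that, folded s_def, folded k_def]
      ode_problem.deriv_le_power[OF that, folded s_def, folded k_def, folded B_def] pos that(2)
    by (simp_all add: powr_mult)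
  have split: "t * t powr (\<phi> - 1) = t powr \<phi>" if "t > 0" for t
    using that by (simp add: powr_diff)
  have V_small: "V t \<le> D * t powr \<phi>"
    if "ode_problem \<gamma> \<phi> lam V" "t > 0" "t \<le> lam powr ((1 + \<gamma>) / (1 - \<gamma>))" for lam V t
  proof -
    have "t * lam \<le> t * t powr (\<phi> - 1)"
      using ode_problem.threshold(1)[OF that] that(2) by (intro mult_left_mono) auto
    with V_upper[OF that(1,2)] split[OF that(2)] show ?thesis
      by (simp add: D_def algebra_simps)
  qed
  have V_large: "V t \<le> D * (lam * t)"
    if "ode_problem \<gamma> \<phi> lam V" "t > 0" "t \<ge> lam powr ((1 + \<gamma>) / (1 - \<gamma>))" for lam V t
  proof -
    have "t * t powr (\<phi> - 1) \<le> t * lam"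
      using ode_problem.threshold(2)[OF that] that(2) by (intro mult_left_mono) auto
    then have "B / \<phi> * t powr \<phi> \<le> B / \<phi> * (t * lam)"
      using pos split[OF that(2)] by (intro mult_left_mono) auto
    with V_upper[OF that(1,2)] show ?thesis
      by (simp add: D_def algebra_simps)
  qed
  have "\<exists>C>0. \<forall>lam>0. \<forall>V. ode_solution \<gamma> lam V \<longrightarrow> (\<forall>t>0.
        (t \<le> lam powr ((1 + \<gamma>) / (1 - \<gamma>)) \<longrightarrow> comparable_with C (V t) (t powr \<phi>)) \<and>
        (t \<ge> lam powr ((1 + \<gamma>) / (1 - \<gamma>)) \<longrightarrow> comparable_with C (V t) (lam * t)))"
  \<comment> \<open>The lower constants are \<open>k powr \<phi>\<close> before the threshold and 1
    after it; D is the upper constant in both cases.\<close>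
  proof (intro exI[of _ "max 1 (max (inverse (k powr \<phi>)) D)"] conjI allI impI)
    fix lam t :: real and V assume *: "lam > 0" "ode_solution \<gamma> lam V" "t > 0"
    then have P: "ode_problem \<gamma> \<phi> lam V"
      using assms by (simp add: ode_problem_def)
    {
      assume "t \<le> lam powr ((1 + \<gamma>) / (1 - \<gamma>))"
      from V_small[OF P *(3) this] V_lower[OF P *(3)] pos
      show "comparable_with (max 1 (max (inverse (k powr \<phi>)) D)) (V t) (t powr \<phi>)"
        by (intro comparable_withI[of "k powr \<phi>" _ _ D]) auto
    next
      assume "t \<ge> lam powr ((1 + \<gamma>) / (1 - \<gamma>))"
      from V_large[OF P *(3) this] ode_problem.V_ge_linear[OF P, of t] * pos
      show "comparable_with (max 1 (max (inverse (k powr \<phi>)) D)) (V t) (lam * t)"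
        by (intro comparable_withI[of 1 _ _ D]) auto
    }
  qed simp
  moreover have "\<exists>C>0. \<forall>lam>0. lam \<ge> c0 \<longrightarrow>
          (\<forall>V. ode_solution \<gamma> lam V \<longrightarrow> comparable_with C (V 1) lam)" if c0: "c0 > 0" for c0
  \<comment> \<open>At \<open>t = 1\<close> the upper bound is \<open>lam + B / \<phi>\<close>, and
    \<open>lam \<ge> c0\<close> absorbs the second term. No case split is made, as 1 may lie on
    either side of the threshold.\<close>
  proof (intro exI[of _ "1 + B / \<phi> / c0"] conjI allI impI)
    show pos': "0 < 1 + B / \<phi> / c0"
      using pos c0 by (intro add_pos_pos divide_pos_pos) auto
    fix lam :: real and V assume *: "lam > 0" "lam \<ge> c0" "ode_solution \<gamma> lam V"
    then have P: "ode_problem \<gamma> \<phi> lam V"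
      using assms by (simp add: ode_problem_def)
    have "B / \<phi> / c0 * c0 \<le> B / \<phi> / c0 * lam"
      using pos c0 * by (intro mult_left_mono) auto
    then have "V 1 \<le> (1 + B / \<phi> / c0) * lam"
      using V_upper[OF P, of 1] c0 by (simp add: algebra_simps)
    with ode_problem.V_ge_linear[OF P, of 1] * c0 pos
    show "comparable_with (1 + B / \<phi> / c0) (V 1) lam"
      by (intro comparable_withI[of 1 _ _ "1 + B / \<phi> / c0"]) auto
  qed
  moreover have "\<exists>C>0. \<forall>lam>0. \<forall>V. ode_solution \<gamma> lam V \<longrightarrow> (\<forall>t>0.
        (t \<le> lam powr ((1 + \<gamma>) / (1 - \<gamma>)) \<longrightarrow> comparable_with C (deriv V t) (t powr (\<phi> - 1))) \<and>
        (t \<ge> lam powr ((1 + \<gamma>) / (1 - \<gamma>)) \<longrightarrow> comparable_with C (deriv V t) lam))"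
  proof (intro exI[of _ "max (inverse m) (1 + B)"] conjI allI impI)
    show "0 < max (inverse m) (1 + B)" using pos by auto
    fix lam t :: real and V assume *: "lam > 0" "ode_solution \<gamma> lam V" "t > 0"
    then have P: "ode_problem \<gamma> \<phi> lam V"
      using assms by (simp add: ode_problem_def)
    {
      assume t: "t \<le> lam powr ((1 + \<gamma>) / (1 - \<gamma>))"
      \<comment> \<open>Before the threshold the bound by lam is too weak, so the upper bound for V
        is passed through the decreasing power in \<open>deriv_ge_power\<close>.\<close>
      have "m * t powr (\<phi> - 1) = s * (D * t powr \<phi>) powr ((1 - \<gamma>) / 2)"
      proof -
        have "(t powr \<phi>) powr ((1 - \<gamma>) / 2) = t powr (\<phi> - 1)"
          unfolding powr_powr ode_problem.phi_half(2)[OF P] ..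
        then show ?thesis using pos D by (simp add: m_def powr_mult)
      qed
      also have "\<dots> \<le> s * V t powr ((1 - \<gamma>) / 2)"
        using V_small[OF P *(3) t] ode_problem.V_pos[OF P *(3)] assms(1) pos D
        by (intro mult_left_mono powr_mono2') auto
      also have "\<dots> \<le> deriv V t"
        using ode_problem.deriv_ge_power[OF P *(3)] by (simp add: s_def)
      finally have "m * t powr (\<phi> - 1) \<le> deriv V t" .
      moreover have "deriv V t \<le> (1 + B) * t powr (\<phi> - 1)"
        using dV_upper[OF P *(3)] ode_problem.threshold(1)[OF P *(3) t]
        by (simp add: algebra_simps)
      ultimately show "comparable_with (max (inverse m) (1 + B)) (deriv V t) (t powr (\<phi> - 1))"
        using pos m by (intro comparable_withI[of m _ _ "1 + B"]) auto
    next
      assume t: "t \<ge> lam powr ((1 + \<gamma>) / (1 - \<gamma>))"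
      have "B * t powr (\<phi> - 1) \<le> B * lam"
        using ode_problem.threshold(2)[OF P *(3) t] pos by (intro mult_left_mono) auto
      then have "deriv V t \<le> (1 + B) * lam"
        using dV_upper[OF P *(3)] by (simp add: algebra_simps)
      with ode_problem.deriv_ge_lam[OF P *(3)] * pos
      show "comparable_with (max (inverse m) (1 + B)) (deriv V t) lam"
        \<comment> \<open>The lower constant 1 is covered because
          \<open>1 + B \<ge> 1\<close>.\<close>
        by (intro comparable_withI[of 1 _ _ "1 + B"]) auto
    }
  qed
  ultimately show ?thesis by blast
qed

end
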